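(* Let $K,L\in\mathcal{S}^n_0$ be two star bodies. Then, for every $m\in\mathbb{N}$, the Hankel matrices $$A_m=\bigl(\widetilde{\mathrm{W}}_{i+j}(K,L)\bigr)_{i,j=0}^m,\qquad B_m=\bigl(\widetilde{\mathrm{W}}_{i+j+1}(K,L)\bigr)_{i,j=0}^{m-1}$$ are positive definite.
   Context: $\mathbb{N}$ denotes the set of positive integers. A star body in $\mathbb{R}^n$ is a nonempty compact set $K\subset\mathbb{R}^n$ which is starshaped with respect to the origin (i.e. $[0,x]\subseteq K$ for all $x\in K$) and whose radial function $\rho_K(u)=\max\{\lambda\ge 0:\lambda u\in K\}$, $u\in\mathbb{S}^{n-1}$, is positive and continuous. $\mathcal{S}^n_0$ denotes the set of all star bodies in $\mathbb{R}^n$. For $K,L\in\mathcal{S}^n_0$ and $i\in\mathbb{R}$, the $i$-th dual quermassintegral is $\widetilde{\mathrm{W}}_i(K,L)=\frac1n\int_{\mathbb{S}^{n-1}}\rho_K(u)^{n-i}\rho_L(u)^i\,d\sigma(u)$, where $\sigma$ is the usual spherical Lebesgue measure.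
   Formalization: Strict positive definiteness fails when L is a dilate of K (e.g. K = L: all entries equal) and for n = 1, m ≥ 2. The formal theorem proves semidefiniteness for all star bodies, and strict positive definiteness when n ≥ 2 and K, L are not dilates of each other. *)

theory Defs
  imports "HOL-Analysis.Analysis" "Jordan_Normal_Form.Matrix"
begin

(* Only meaningful where the maximum exists; see radial_function_is_max. *)
definition radial_function :: "(real ^ 'n) set \<Rightarrow> real ^ 'n \<Rightarrow> real" where
  "radial_function K u = (GREATEST r. 0 \<le> r \<and> r *\<^sub>R u \<in> K)"

definition star_body :: "(real ^ 'n) set \<Rightarrow> bool" where
  "star_body K \<longleftrightarrow>
     K \<noteq> {} \<and> compact K \<and> (\<forall>x\<in>K. closed_segment 0 x \<subseteq> K) \<and>
     (\<forall>u\<in>sphere 0 1. 0 < radial_function K u) \<and>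
     continuous_on (sphere 0 1) (radial_function K)"

lemma radial_function_is_max:
  fixes K :: "(real ^ 'n) set"
  assumes "compact K" "K \<noteq> {}" "\<forall>x\<in>K. closed_segment 0 x \<subseteq> K" and u: "u \<in> sphere 0 1"
  shows "0 \<le> radial_function K u" "radial_function K u *\<^sub>R u \<in> K"
    and "\<And>r. 0 \<le> r \<Longrightarrow> r *\<^sub>R u \<in> K \<Longrightarrow> r \<le> radial_function K u"
proof -
  define S where "S = {r. 0 \<le> r \<and> r *\<^sub>R u \<in> K}"
  obtain B where B: "\<forall>x\<in>K. norm x \<le> B"
    using compact_imp_bounded[OF assms(1)] bounded_iff by blast
  have "0 \<in> K" using assms(2,3) by auto
  then have ne: "S \<noteq> {}" by (auto simp: S_def intro!: exI[of _ 0])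
  have "S \<subseteq> {0..B}" using B u by (force simp: S_def)
  then have bd: "bounded S" using bounded_closed_interval bounded_subset by blast
  have "closed ({0..} \<inter> (\<lambda>r. r *\<^sub>R u) -` K)"
    by (intro closed_Int closed_atLeast continuous_closed_vimage
        compact_imp_closed[OF assms(1)] continuous_intros)
  also have "{0..} \<inter> (\<lambda>r. r *\<^sub>R u) -` K = S" by (auto simp: S_def)
  finally have "compact S" using bd compact_eq_bounded_closed by blast
  then obtain s where s: "s \<in> S" "\<forall>t\<in>S. t \<le> s" using compact_attains_sup ne by blast
  have "radial_function K u = s"
    unfolding radial_function_def by (rule Greatest_equality) (use s in \<open>auto simp: S_def\<close>)
  then show "0 \<le> radial_function K u" "radial_function K u *\<^sub>R u \<in> K"
    "\<And>r. 0 \<le> r \<Longrightarrow> r *\<^sub>R u \<in> K \<Longrightarrow> r \<le> radial_function K u"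
    using s by (auto simp: S_def)
qed

(* Spherical Lebesgue measure as the cone measure: sigma(A) is n times the volume of
   {t u | 0 < t \<le> 1, u \<in> A}, cf. emeasure_spherical_lebesgue.  The library has no
   surface measure. For n = 1 this is counting measure on {-1, 1}. *)
definition spherical_lebesgue :: "(real ^ 'n) measure" where
  "spherical_lebesgue =
     scale_measure (of_nat CARD('n))
       (distr (restrict_space lborel (cball 0 1 - {0})) (restrict_space borel (sphere 0 1))
          (\<lambda>x. x /\<^sub>R norm x))"

lemma emeasure_spherical_lebesgue:
  fixes A :: "(real ^ 'n) set"
  assumes A: "A \<in> sets borel" "A \<subseteq> sphere 0 1"
  shows "emeasure spherical_lebesgue A =
    of_nat CARD('n) * emeasure lborel {t *\<^sub>R u | t u. 0 < t \<and> t \<le> 1 \<and> u \<in> A}"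
proof -
  let ?D = "cball 0 1 - {0} :: (real ^ 'n) set"
  let ?N = "restrict_space borel (sphere 0 1) :: (real ^ 'n) measure"
  have "(\<lambda>x :: real ^ 'n. x /\<^sub>R norm x) \<in> restrict_space lborel ?D \<rightarrow>\<^sub>M borel"
    by (intro measurable_restrict_space1) measurable
  then have m: "(\<lambda>x :: real ^ 'n. x /\<^sub>R norm x) \<in> restrict_space lborel ?D \<rightarrow>\<^sub>M ?N"
    by (rule measurable_restrict_space2[rotated]) (auto simp: space_restrict_space)
  have AN: "A \<in> sets ?N" using A by (auto simp: sets_restrict_space)
  have "(\<lambda>x. x /\<^sub>R norm x) -` A \<inter> ?D = {t *\<^sub>R u | t u. 0 < t \<and> t \<le> 1 \<and> u \<in> A}" (is "?L = ?R")
  proof (rule subset_antisym; rule subsetI)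
    fix x assume "x \<in> ?L"
    then have "x = norm x *\<^sub>R (x /\<^sub>R norm x) \<and> 0 < norm x \<and> norm x \<le> 1 \<and> x /\<^sub>R norm x \<in> A"
      by auto
    then show "x \<in> ?R" by blast
  next
    fix x assume "x \<in> ?R"
    then obtain t u where "x = t *\<^sub>R u" "0 < t" "t \<le> 1" "u \<in> A" by blast
    moreover have "norm u = 1" using \<open>u \<in> A\<close> A(2) by auto
    ultimately show "x \<in> ?L" by auto
  qed
  moreover have "emeasure (restrict_space lborel ?D) ?R = emeasure lborel ?R"
    using A(2) by (intro emeasure_restrict_space) (force simp: subset_iff)+
  ultimately show ?thesis
    using m AN by (simp add: spherical_lebesgue_def emeasure_distr space_restrict_space)
qed

definition dual_quermassintegral :: "(real ^ 'n) set \<Rightarrow> (real ^ 'n) set \<Rightarrow> real \<Rightarrow> real" where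
  "dual_quermassintegral K L i =
     (1 / real CARD('n)) *
     (LINT u|spherical_lebesgue.
        radial_function K u powr (real CARD('n) - i) * radial_function L u powr i)"

definition hankel_A :: "(real ^ 'n) set \<Rightarrow> (real ^ 'n) set \<Rightarrow> nat \<Rightarrow> real mat" where
  "hankel_A K L m =
     Matrix.mat (m + 1) (m + 1) (\<lambda>(i, j). dual_quermassintegral K L (real (i + j)))"

definition hankel_B :: "(real ^ 'n) set \<Rightarrow> (real ^ 'n) set \<Rightarrow> nat \<Rightarrow> real mat" where
  "hankel_B K L m =
     Matrix.mat m m (\<lambda>(i, j). dual_quermassintegral K L (real (i + j + 1)))"

definition positive_semidefinite_mat :: "real mat \<Rightarrow> bool" where
  "positive_semidefinite_mat A \<longleftrightarrow>
     square_mat A \<and> A\<^sup>T = A \<and>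
     (\<forall>v\<in>carrier_vec (dim_row A). 0 \<le> scalar_prod v (A *\<^sub>v v))"

definition positive_definite_mat :: "real mat \<Rightarrow> bool" where
  "positive_definite_mat A \<longleftrightarrow>
     square_mat A \<and> A\<^sup>T = A \<and>
     (\<forall>v\<in>carrier_vec (dim_row A). v \<noteq> 0\<^sub>v (dim_row A) \<longrightarrow> 0 < scalar_prod v (A *\<^sub>v v))"

(* If L = c K then the i-th dual quermassintegral is c^i vol(K), so the Hankel matrices have
   rank one; strict definiteness therefore needs K and L not to be dilates (and n \<ge> 2, since
   for n = 1 the quotient of the radial functions takes at most two values). *)
definition dilates :: "(real ^ 'n) set \<Rightarrow> (real ^ 'n) set \<Rightarrow> bool" where
  "dilates K L \<longleftrightarrow> (\<exists>c>0. L = (\<lambda>x. c *\<^sub>R x) ` K)"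

end

theory Submission
  imports Defs
begin

text \<open>
  Put \<open>q = \<rho>\<^sub>L / \<rho>\<^sub>K\<close>. The integrand of the \<open>k\<close>-th dual quermassintegral is
  \<open>\<rho>\<^sub>K\<^sup>n q\<^sup>k\<close>, so \<open>W\<^sub>0, W\<^sub>1, \<dots>\<close> is the moment sequence of the continuous function \<open>q\<close> for
  the positive weight \<open>\<rho>\<^sub>K\<^sup>n / n\<close> on the sphere, and \<open>W\<^sub>1, W\<^sub>2, \<dots>\<close> is the one for the
  positive weight \<open>\<rho>\<^sub>K\<^sup>n q / n\<close>. For a weight \<open>w\<close>, the quadratic form of the Hankel matrix of
  moments at a vector \<open>v\<close> is the integral of \<open>w p(q)\<^sup>2\<close>, where \<open>p\<close> is the polynomial with
  coefficients \<open>v\<close> (lemma \<open>hankel_quadratic_form\<close>); this gives semidefiniteness for both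
  matrices at once.

  Spherical Lebesgue measure charges every nonempty open subset of the sphere
  (\<open>spherical_integral_pos\<close>). Hence, if the form vanishes at \<open>v\<close>, then \<open>p\<close> vanishes on the whole
  range of \<open>q\<close>. For \<open>n \<ge> 2\<close> the sphere is connected, so this range is an interval: either it
  is infinite, and then \<open>p = 0\<close>, or \<open>q\<close> is a constant \<open>c\<close>. In the latter case \<open>L = c K\<close>, because
  a star body is determined by its radial function (\<open>star_body_mem_iff\<close>).
\<close>

section \<open>Integration over the sphere\<close>

lemma sets_spherical_lebesgue:
  "sets (spherical_lebesgue :: (real ^ 'n) measure) = sets (restrict_space borel (sphere 0 1))"
  by (simp add: spherical_lebesgue_def)

lemma space_spherical_lebesgue: "space (spherical_lebesgue :: (real ^ 'n) measure) = sphere 0 1"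
  using sets_eq_imp_space_eq[OF sets_spherical_lebesgue] by (simp add: space_restrict_space)

lemma finite_measure_spherical_lebesgue:
  "finite_measure (spherical_lebesgue :: (real ^ 'n) measure)"
proof
  let ?C = "{t *\<^sub>R u | t u. 0 < t \<and> t \<le> 1 \<and> u \<in> sphere (0 :: real ^ 'n) 1}"
  have "emeasure lborel ?C \<le> emeasure lborel (cball (0 :: real ^ 'n) 1)"
    by (rule emeasure_mono) auto
  also have "\<dots> < \<infinity>"
    by (rule emeasure_lborel_cball_finite)
  finally have "emeasure lborel ?C < \<infinity>" .
  then show "emeasure spherical_lebesgue (space (spherical_lebesgue :: (real ^ 'n) measure)) \<noteq> \<infinity>"
    unfolding space_spherical_lebesgue
    by (subst emeasure_spherical_lebesgue) (auto simp: ennreal_mult_eq_top_iff)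
qed

lemma integrable_spherical_lebesgue:
  fixes f :: "real ^ 'n \<Rightarrow> real"
  assumes f: "continuous_on (sphere 0 1) f"
  shows "integrable spherical_lebesgue f"
proof -
  interpret finite_measure "spherical_lebesgue :: (real ^ 'n) measure"
    by (rule finite_measure_spherical_lebesgue)
  have "bounded (f ` sphere 0 1)"
    by (intro compact_imp_bounded compact_continuous_image f) simp
  then obtain B where B: "\<And>u. u \<in> sphere 0 1 \<Longrightarrow> norm (f u) \<le> B"
    unfolding bounded_iff by blast
  have "f \<in> borel_measurable (restrict_space borel (sphere 0 1))"
    using f by (rule borel_measurable_continuous_on_restrict)
  then have "f \<in> borel_measurable spherical_lebesgue"
    by (simp add: measurable_cong_sets[OF sets_spherical_lebesgue refl])
  then show ?thesis
    using B by (intro integrable_const_bound[of _ B] AE_I2) (auto simp: space_spherical_lebesgue)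
qed

text \<open>The cone over a nonempty relatively open subset of the sphere contains a nonempty open
  subset of the ball, so that the subset has positive measure.\<close>

lemma spherical_integral_pos:
  fixes f :: "real ^ 'n \<Rightarrow> real"
  assumes f: "continuous_on (sphere 0 1) f"
    and nonneg: "\<And>u. u \<in> sphere 0 1 \<Longrightarrow> 0 \<le> f u"
    and u0: "u0 \<in> sphere 0 1" "f u0 \<noteq> 0"
  shows "0 < (LINT u|spherical_lebesgue. f u)"
proof -
  let ?M = "spherical_lebesgue :: (real ^ 'n) measure"
  let ?A = "{u \<in> sphere 0 1. f u \<noteq> 0}"
  let ?C = "{t *\<^sub>R u | t u. 0 < t \<and> t \<le> 1 \<and> u \<in> ?A}"
  let ?O = "(ball 0 1 - {0}) \<inter> (\<lambda>x. f (x /\<^sub>R norm x)) -` (- {0})"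
  have int: "integrable ?M f"
    using f by (rule integrable_spherical_lebesgue)
  have AE_nonneg: "AE u in ?M. 0 \<le> f u"
    by (intro AE_I2) (simp add: space_spherical_lebesgue nonneg)
  have "(LINT u|?M. f u) \<noteq> 0"
  proof
    assume "(LINT u|?M. f u) = 0"
    then have AE0: "AE u in ?M. f u = 0"
      using integral_nonneg_eq_0_iff_AE[OF int AE_nonneg] by simp
    have A_sets: "?A \<in> sets ?M"
      using borel_measurable_integrable[OF int] by (auto simp flip: space_spherical_lebesgue)
    have null: "emeasure ?M ?A = 0"
      using AE0 A_sets by (simp add: AE_iff_measurable[OF A_sets] space_spherical_lebesgue)
    have A_borel: "?A \<in> sets borel"
      using A_sets by (auto simp: sets_spherical_lebesgue sets_restrict_space)
    have C0: "emeasure lborel ?C = 0"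
      using null by (subst (asm) emeasure_spherical_lebesgue[OF A_borel]) auto
    have "open ?O"
    proof (rule continuous_open_preimage)
      show "continuous_on (ball 0 1 - {0}) (\<lambda>x. f (x /\<^sub>R norm x))"
        by (rule continuous_on_compose2[OF f])
          (auto intro!: continuous_intros simp: field_simps split: if_splits)
    qed auto
    moreover have "(1 / 2) *\<^sub>R u0 \<in> ?O"
      using u0 by auto
    ultimately have "\<not> negligible ?O"
      using open_not_negligible by blast
    moreover have "?O \<subseteq> ?C"
    proof
      fix x assume x: "x \<in> ?O"
      then have "x = norm x *\<^sub>R (x /\<^sub>R norm x) \<and> 0 < norm x \<and> norm x \<le> 1 \<and> x /\<^sub>R norm x \<in> ?A"
        by auto
      then show "x \<in> ?C" by blast
    qed
    moreover have "?C \<in> sets lborel"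
    proof -
      have "?C = (cball 0 1 - {0}) \<inter> (\<lambda>x. x /\<^sub>R norm x) -` ?A"
      proof (intro equalityI subsetI)
        fix x assume x: "x \<in> (cball 0 1 - {0}) \<inter> (\<lambda>x. x /\<^sub>R norm x) -` ?A"
        then have "x = norm x *\<^sub>R (x /\<^sub>R norm x) \<and> 0 < norm x \<and> norm x \<le> 1 \<and> x /\<^sub>R norm x \<in> ?A"
          by auto
        then show "x \<in> ?C" by blast
      qed auto
      moreover have "(\<lambda>x :: real ^ 'n. x /\<^sub>R norm x) -` ?A \<inter> space borel \<in> sets borel"
        by (rule measurable_sets[OF _ A_borel]) measurable
      ultimately show ?thesis by auto
    qed
    ultimately show False
      using C0 null_sets_completionI[of ?C lborel] negligible_iff_null_sets negligible_subset
      by blast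
  qed
  moreover have "0 \<le> (LINT u|?M. f u)"
    using AE_nonneg by (rule integral_nonneg_AE)
  ultimately show ?thesis by simp
qed

section \<open>Hankel matrices of moments\<close>

lemma hankel_quadratic_form:
  fixes w q :: "'a \<Rightarrow> real"
  assumes int: "\<And>k. integrable M (\<lambda>u. w u * q u ^ k)" and v: "v \<in> carrier_vec N"
  shows "scalar_prod v (Matrix.mat N N (\<lambda>(i, j). LINT u|M. w u * q u ^ (i + j)) *\<^sub>v v)
    = (LINT u|M. w u * (\<Sum>i<N. vec_index v i * q u ^ i)\<^sup>2)"
proof -
  have square: "w u * (\<Sum>i<N. vec_index v i * q u ^ i)\<^sup>2
      = (\<Sum>i<N. \<Sum>j<N. (vec_index v i * vec_index v j) * (w u * q u ^ (i + j)))" for u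
    by (simp add: power2_eq_square sum_product sum_distrib_left power_add mult_ac)
  have "scalar_prod v (Matrix.mat N N (\<lambda>(i, j). LINT u|M. w u * q u ^ (i + j)) *\<^sub>v v)
    = (\<Sum>i<N. \<Sum>j<N. (vec_index v i * vec_index v j) * (LINT u|M. w u * q u ^ (i + j)))"
    using v by (auto simp: scalar_prod_def sum_distrib_left lessThan_atLeast0 mult_ac
        intro!: sum.cong)
  also have "\<dots> = (LINT u|M. w u * (\<Sum>i<N. vec_index v i * q u ^ i)\<^sup>2)"
    unfolding square by (simp add: Bochner_Integration.integral_sum int)
  finally show ?thesis .
qed

lemma polynomial_coeffs_zero_if_infinite_roots:
  fixes v :: "real Matrix.vec"
  assumes v: "v \<in> carrier_vec N" and S: "infinite S"
    and root: "\<And>x. x \<in> S \<Longrightarrow> (\<Sum>i<N. vec_index v i * x ^ i) = 0"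
  shows "v = 0\<^sub>v N"
proof (cases N)
  case 0
  then show ?thesis using v by auto
next
  case (Suc n)
  have "infinite {x. (\<Sum>i\<le>n. vec_index v i * x ^ i) = 0}"
    using root infinite_super[OF _ S] by (simp add: Suc lessThan_Suc_atMost subset_iff)
  then have "\<forall>i\<le>n. vec_index v i = 0"
    using polyfun_finite_roots[of "vec_index v" n] by simp
  then show ?thesis using v Suc by (intro eq_vecI) auto
qed

context
  fixes w q :: "real ^ 'n \<Rightarrow> real" and N :: nat and H :: "real mat"
  assumes w: "continuous_on (sphere 0 1) w" "\<And>u. u \<in> sphere 0 1 \<Longrightarrow> 0 < w u"
    and q: "continuous_on (sphere 0 1) q"
    and H: "H = Matrix.mat N N (\<lambda>(i, j). LINT u|spherical_lebesgue. w u * q u ^ (i + j))"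
begin

lemma spherical_hankel_quadratic_form:
  assumes "v \<in> carrier_vec N"
  shows "scalar_prod v (H *\<^sub>v v)
    = (LINT u|spherical_lebesgue. w u * (\<Sum>i<N. vec_index v i * q u ^ i)\<^sup>2)"
  unfolding H
  by (intro hankel_quadratic_form integrable_spherical_lebesgue assms continuous_intros w q)

lemma transpose_spherical_hankel: "H\<^sup>T = H"
  unfolding H by (intro eq_matI) (auto simp: add.commute)

lemma positive_semidefinite_spherical_hankel: "positive_semidefinite_mat H"
proof -
  have "0 \<le> scalar_prod v (H *\<^sub>v v)" if "v \<in> carrier_vec N" for v
    unfolding spherical_hankel_quadratic_form[OF that]
    by (intro integral_nonneg_AE AE_I2) (simp add: space_spherical_lebesgue w(2) less_imp_le)
  then show ?thesis
    unfolding positive_semidefinite_mat_def using transpose_spherical_hankel by (simp add: H)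
qed

text \<open>A continuous function with infinitely many values cannot be annihilated by a nonzero
  polynomial, and a nonconstant function on a connected set has infinitely many values.\<close>

lemma positive_definite_spherical_hankel:
  assumes card: "2 \<le> CARD('n)" and nonconst: "\<not> q constant_on sphere 0 1"
  shows "positive_definite_mat H"
proof -
  have "connected (q ` sphere 0 1)"
    using card by (intro connected_continuous_image q connected_sphere) simp
  moreover have "\<not> q ` sphere 0 1 \<subseteq> {c}" for c
    using nonconst unfolding constant_on_def by blast
  ultimately have inf: "infinite (q ` sphere 0 1)"
    using connected_finite_iff_sing by (metis empty_subsetI order_refl)
  have "0 < scalar_prod v (H *\<^sub>v v)" if v: "v \<in> carrier_vec N" "v \<noteq> 0\<^sub>v N" for v
  proof -
    obtain u0 where u0: "u0 \<in> sphere 0 1" "(\<Sum>i<N. vec_index v i * q u0 ^ i) \<noteq> 0"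
      using polynomial_coeffs_zero_if_infinite_roots[OF v(1) inf] v(2) by blast
    show ?thesis
      unfolding spherical_hankel_quadratic_form[OF v(1)]
    proof (rule spherical_integral_pos[OF _ _ u0(1)])
      show "w u0 * (\<Sum>i<N. vec_index v i * q u0 ^ i)\<^sup>2 \<noteq> 0"
        using u0 w(2)[OF u0(1)] by simp
    qed (auto intro!: continuous_intros w q simp: w(2) less_imp_le)
  qed
  then show ?thesis
    unfolding positive_definite_mat_def using transpose_spherical_hankel by (simp add: H)
qed

end

section \<open>Star bodies and their radial functions\<close>

lemma star_body_mem_iff:
  fixes K :: "(real ^ 'n) set"
  assumes K: "star_body K"
  shows "x \<in> K \<longleftrightarrow> x = 0 \<or> norm x \<le> radial_function K (x /\<^sub>R norm x)"
proof (cases "x = 0")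
  case True
  then show ?thesis using K unfolding star_body_def by auto
next
  case False
  define u where "u = x /\<^sub>R norm x"
  have u: "u \<in> sphere 0 1" and x: "x = norm x *\<^sub>R u"
    using False by (auto simp: u_def)
  have star: "compact K" "K \<noteq> {}" "\<forall>x\<in>K. closed_segment 0 x \<subseteq> K"
    and pos: "0 < radial_function K u"
    using K u unfolding star_body_def by auto
  note max = radial_function_is_max[OF star u]
  show ?thesis
  proof
    assume "x \<in> K"
    then show "x = 0 \<or> norm x \<le> radial_function K (x /\<^sub>R norm x)"
      using max(3)[of "norm x"] x by (simp flip: u_def)
  next
    assume "x = 0 \<or> norm x \<le> radial_function K (x /\<^sub>R norm x)"
    then have le: "norm x \<le> radial_function K u"
      using False by (simp add: u_def)
    have "x = (norm x / radial_function K u) *\<^sub>R (radial_function K u *\<^sub>R u)"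
      using pos x by simp
    moreover have "0 \<le> norm x / radial_function K u" "norm x / radial_function K u \<le> 1"
      using le pos by auto
    ultimately have "x \<in> closed_segment 0 (radial_function K u *\<^sub>R u)"
      unfolding in_segment by (metis add_0 scaleR_zero_right)
    then show "x \<in> K" using max(2) star(3) by blast
  qed
qed

lemma dilates_if_radial_quotient_constant:
  fixes K L :: "(real ^ 'n) set"
  assumes K: "star_body K" and L: "star_body L"
    and const: "(\<lambda>u. radial_function L u / radial_function K u) constant_on sphere 0 1"
  shows "dilates K L"
proof -
  have pos: "0 < radial_function K u" "0 < radial_function L u" if "u \<in> sphere 0 1" for u
    using K L that unfolding star_body_def by auto
  obtain c where c: "\<And>u. u \<in> sphere 0 1 \<Longrightarrow> radial_function L u / radial_function K u = c"
    using const unfolding constant_on_def by blast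
  obtain u1 :: "real ^ 'n" where u1: "u1 \<in> sphere 0 1"
    using vector_choose_size[of 1] by auto
  have c_pos: "0 < c"
    using c[OF u1] pos[OF u1] by (metis divide_pos_pos)
  have rad: "radial_function L u = c * radial_function K u" if "u \<in> sphere 0 1" for u
    using c[OF that] pos[OF that] by (simp add: field_simps)
  have "x \<in> L \<longleftrightarrow> x /\<^sub>R c \<in> K" for x
  proof (cases "x = 0")
    case False
    then have "x /\<^sub>R norm x \<in> sphere 0 1" by simp
    moreover have "(x /\<^sub>R c) /\<^sub>R norm (x /\<^sub>R c) = x /\<^sub>R norm x"
      using c_pos by simp
    ultimately show ?thesis
      using False c_pos by (simp add: star_body_mem_iff[OF K] star_body_mem_iff[OF L] rad field_simps)
  qed (simp add: star_body_mem_iff[OF K] star_body_mem_iff[OF L])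
  then have "L = (\<lambda>x. c *\<^sub>R x) ` K"
    using c_pos by (auto simp: image_iff intro!: bexI[of _ "_ /\<^sub>R c"])
  then show ?thesis
    using c_pos unfolding dilates_def by blast
qed

lemma dual_quermassintegral_eq_moment:
  fixes K L :: "(real ^ 'n) set"
  assumes K: "star_body K" and L: "star_body L"
  shows "dual_quermassintegral K L (real k) =
    (LINT u|spherical_lebesgue.
       radial_function K u ^ CARD('n) / real CARD('n) *
         (radial_function L u / radial_function K u) ^ k)"
proof -
  have "radial_function K u powr (real CARD('n) - real k) * radial_function L u powr real k
      = radial_function K u ^ CARD('n) * (radial_function L u / radial_function K u) ^ k"
    if "u \<in> sphere 0 1" for u
  proof -
    have "0 < radial_function K u" "0 < radial_function L u"
      using K L that unfolding star_body_def by auto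
    then show ?thesis
      by (simp add: powr_diff powr_realpow power_divide)
  qed
  then show ?thesis
    unfolding dual_quermassintegral_def
    by (auto simp flip: integral_mult_right_zero simp: space_spherical_lebesgue
        intro!: Bochner_Integration.integral_cong)
qed

theorem theorem1p2:
  fixes K L :: "(real ^ 'n) set" and m :: nat
  assumes "star_body K" and "star_body L" and "1 \<le> m"
  shows "positive_semidefinite_mat (hankel_A K L m) \<and>
         positive_semidefinite_mat (hankel_B K L m) \<and>
         (2 \<le> CARD('n) \<and> \<not> dilates K L \<longrightarrow>
            positive_definite_mat (hankel_A K L m) \<and> positive_definite_mat (hankel_B K L m))"
proof -
  define q where "q u = radial_function L u / radial_function K u" for u
  define w where "w u = radial_function K u ^ CARD('n) / real CARD('n)" for u
  have pos: "0 < radial_function K u" "0 < radial_function L u" if "u \<in> sphere 0 1" for u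
    using assms that unfolding star_body_def by auto
  have cont: "continuous_on (sphere 0 1) (radial_function K)"
      "continuous_on (sphere 0 1) (radial_function L)"
    using assms unfolding star_body_def by auto
  have q: "continuous_on (sphere 0 1) q"
    unfolding q_def using pos by (intro continuous_intros cont) force
  have w: "continuous_on (sphere 0 1) w"
    unfolding w_def by (intro continuous_intros cont) auto
  have wq: "continuous_on (sphere 0 1) (\<lambda>u. w u * q u)"
    by (intro continuous_intros w q)
  have w_pos: "0 < w u" and wq_pos: "0 < w u * q u" if "u \<in> sphere 0 1" for u
    using pos[OF that] by (auto simp: w_def q_def)
  have moment: "dual_quermassintegral K L (real k) = (LINT u|spherical_lebesgue. w u * q u ^ k)" for k
    unfolding w_def q_def by (rule dual_quermassintegral_eq_moment[OF assms(1,2)])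
  have A: "hankel_A K L m = Matrix.mat (m + 1) (m + 1)
      (\<lambda>(i, j). LINT u|spherical_lebesgue. w u * q u ^ (i + j))"
    unfolding hankel_A_def moment ..
  have B: "hankel_B K L m = Matrix.mat m m
      (\<lambda>(i, j). LINT u|spherical_lebesgue. w u * q u * q u ^ (i + j))"
    unfolding hankel_B_def moment by (simp add: mult.assoc)
  have nonconst: "\<not> q constant_on sphere 0 1" if "\<not> dilates K L"
    using dilates_if_radial_quotient_constant[OF assms(1,2)] that unfolding q_def by blast
  show ?thesis
    using positive_semidefinite_spherical_hankel[OF w w_pos q A]
      positive_semidefinite_spherical_hankel[OF wq wq_pos q B]
      positive_definite_spherical_hankel[OF w w_pos q A _ nonconst]
      positive_definite_spherical_hankel[OF wq wq_pos q B _ nonconst]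
    by blast
qed

end
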